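(* Lattice path matroids are Ehrhart positive. That is, for all integers $0\le k\le n$ and all lattice paths $L,U$ from $(0,0)$ to $(n-k,k)$ such that $L$ lies below $U$, all the coefficients of the Ehrhart polynomial $\operatorname{ehr}(\mathscr{P}(\mathsf{M}[L,U]),t)\in\mathbb{Q}[t]$ of the base polytope of the lattice path matroid $\mathsf{M}[L,U]$ are nonnegative.
   Context: Lattice paths: for $0\le k\le n$, consider lattice paths from $(0,0)$ to $(n-k,k)$ with exactly $n$ steps, each equal to $+(1,0)$ (East, E) or $+(0,1)$ (North, N). For such a path $P$, let $s(P)\subseteq[n]=\{1,\dots,n\}$ be the set of positions of its north steps (so $|s(P)|=k$). A path $L$ lies below a path $U$ (equivalently $U$ lies above $L$) if $|s(L)\cap[m]|\le |s(U)\cap[m]|$ for every $m=1,\dots,n$. Lattice path matroid: if $L$ lies below $U$, the family $\mathscr{B}[L,U]=\{s(P): P \text{ a lattice path lying above } L \text{ and below } U\}$ is the set of bases of a matroid of rank $k$ on $[n]$, denoted $\mathsf{M}[L,U]$. Lattice path matroids are the matroids of this form (up to isomorphism). Base polytope: for a matroid $\mathsf{M}$ on $[n]$, $\mathscr{P}(\mathsf{M})\subset\mathbb{R}^n$ is the convex hull of the indicator vectors $e_B=\sum_{i\in B}e_i$ of the bases $B$ of $\mathsf{M}$. Ehrhart polynomial: for a lattice polytope $P\subset\mathbb{R}^n$, $\operatorname{ehr}(P,t)\in\mathbb{Q}[t]$ is the unique polynomial with $\operatorname{ehr}(P,m)=|mP\cap\mathbb{Z}^n|$ for all integers $m\ge0$.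 $P$ is Ehrhart positive if all coefficients of $\operatorname{ehr}(P,t)$ are nonnegative; a matroid is Ehrhart positive if its base polytope is. *)

theory Defs
  imports "HOL-Analysis.Analysis" "HOL-Analysis.Finite_Function_Topology" "HOL-Computational_Algebra.Polynomial"
begin

section \<open>Lattice paths\<close>

datatype step = East | North

fun step_vector :: "step \<Rightarrow> nat \<times> nat" where
  "step_vector East = (1, 0)"
| "step_vector North = (0, 1)"

text \<open>The lattice paths from \<open>(0, 0)\<close> to \<open>(n - k, k)\<close>; only meaningful for \<open>k \<le> n\<close>, since
  subtraction on \<^typ>\<open>nat\<close> truncates.\<close>

definition lattice_paths :: "nat \<Rightarrow> nat \<Rightarrow> step list set" where
  "lattice_paths n k = {P. length P = n \<and> sum_list (map step_vector P) = (n - k, k)}"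

text \<open>Positions are counted from 1, list indices from 0.\<close>

definition north_steps :: "step list \<Rightarrow> nat set" where
  "north_steps P = {i \<in> {1..length P}. P ! (i - 1) = North}"

text \<open>\<open>lies_below n P Q\<close>: among paths with \<open>n\<close> steps, \<open>P\<close> lies below \<open>Q\<close>.\<close>

definition lies_below :: "nat \<Rightarrow> step list \<Rightarrow> step list \<Rightarrow> bool" where
  "lies_below n P Q \<longleftrightarrow>
     (\<forall>m\<in>{1..n}. card (north_steps P \<inter> {1..m}) \<le> card (north_steps Q \<inter> {1..m}))"


section \<open>Matroids, given by their bases\<close>

record 'a matroid =
  ground :: "'a set"
  bases :: "'a set set"

definition is_matroid :: "'a matroid \<Rightarrow> bool" where
  "is_matroid M \<longleftrightarrow> finite (ground M) \<and> bases M \<noteq> {} \<and> (\<forall>B\<in>bases M. B \<subseteq> ground M) \<and>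
     (\<forall>A\<in>bases M. \<forall>B\<in>bases M. \<forall>x\<in>A - B. \<exists>y\<in>B - A. insert y (A - {x}) \<in> bases M)"

definition lattice_path_bases :: "nat \<Rightarrow> nat \<Rightarrow> step list \<Rightarrow> step list \<Rightarrow> nat set set" where
  "lattice_path_bases n k L U =
     north_steps ` {P \<in> lattice_paths n k. lies_below n L P \<and> lies_below n P U}"

definition lattice_path_matroid :: "nat \<Rightarrow> nat \<Rightarrow> step list \<Rightarrow> step list \<Rightarrow> nat matroid" where
  "lattice_path_matroid n k L U = \<lparr>ground = {1..n}, bases = lattice_path_bases n k L U\<rparr>"


section \<open>Base polytopes and Ehrhart polynomials\<close>

text \<open>The dimension \<open>n\<close> varies, so \<open>\<real>\<^sup>n\<close> is taken to be the subspace of all vectors supported on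
  \<open>{1..n}\<close> of the real vector space \<^typ>\<open>nat \<Rightarrow>\<^sub>0 real\<close>. Convex hulls, dilations and integer points
  do not depend on whether they are taken in this subspace or in the whole space.\<close>

definition indicator_vector :: "'a set \<Rightarrow> 'a \<Rightarrow>\<^sub>0 real" where
  "indicator_vector B = (\<Sum>i\<in>B. Poly_Mapping.single i 1)"

definition base_polytope :: "'a matroid \<Rightarrow> ('a \<Rightarrow>\<^sub>0 real) set" where
  "base_polytope M = convex hull (indicator_vector ` bases M)"

definition integer_points :: "('a \<Rightarrow>\<^sub>0 real) set" where
  "integer_points = {x. \<forall>i. Poly_Mapping.lookup x i \<in> \<int>}"

definition is_ehrhart_polynomial :: "('a \<Rightarrow>\<^sub>0 real) set \<Rightarrow> rat poly \<Rightarrow> bool" where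
  "is_ehrhart_polynomial P p \<longleftrightarrow>
     (\<forall>m::nat. poly p (of_nat m) = of_nat (card ((\<lambda>v. real m *\<^sub>R v) ` P \<inter> integer_points)))"

text \<open>Uniqueness is lemma \<open>is_ehrhart_polynomial_unique\<close> below; that such a polynomial exists for a
  lattice polytope is Ehrhart's theorem, which is not proved here. Without existence the value of
  \<open>THE\<close> is unspecified.\<close>

definition ehrhart_polynomial :: "('a \<Rightarrow>\<^sub>0 real) set \<Rightarrow> rat poly" where
  "ehrhart_polynomial P = (THE p. is_ehrhart_polynomial P p)"


section \<open>Well-definedness\<close>

lemma is_ehrhart_polynomial_unique:
  assumes "is_ehrhart_polynomial P p" "is_ehrhart_polynomial P q"
  shows "p = q"
proof (rule ccontr)
  assume "p \<noteq> q"
  then have "finite {x. poly (p - q) x = 0}"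
    by (intro poly_roots_finite) simp
  moreover have "range of_nat \<subseteq> {x. poly (p - q) x = 0}"
    using assms by (auto simp: is_ehrhart_polynomial_def)
  ultimately have "finite (range (of_nat :: nat \<Rightarrow> rat))"
    using finite_subset by blast
  then show False
    by (simp add: finite_image_iff inj_of_nat)
qed

lemma ehrhart_polynomial_eqI:
  assumes "is_ehrhart_polynomial P p"
  shows "ehrhart_polynomial P = p"
  unfolding ehrhart_polynomial_def
  using assms is_ehrhart_polynomial_unique by blast

lemma north_steps_subset: "north_steps P \<subseteq> {1..length P}"
  by (auto simp: north_steps_def)

lemma north_steps_snoc:
  "north_steps (P @ [s]) = (if s = North then insert (Suc (length P)) (north_steps P) else north_steps P)"
  by (auto simp: north_steps_def nth_append le_Suc_eq)

lemma sum_step_vectors: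
  "sum_list (map step_vector P) = (length P - card (north_steps P), card (north_steps P))"
proof (induction P rule: rev_induct)
  case Nil
  then show ?case by (simp add: north_steps_def zero_prod_def)
next
  case (snoc s P)
  have fin: "finite (north_steps P)" and notin: "Suc (length P) \<notin> north_steps P"
    using north_steps_subset[of P] finite_subset by (blast, auto)
  have "card (north_steps P) \<le> length P"
    using card_mono[OF _ north_steps_subset[of P]] by simp
  then show ?case
    using snoc fin notin by (cases s) (auto simp: north_steps_snoc Suc_diff_le)
qed

lemma lattice_paths_iff:
  "k \<le> n \<Longrightarrow> P \<in> lattice_paths n k \<longleftrightarrow> length P = n \<and> card (north_steps P) = k"
  by (auto simp: lattice_paths_def sum_step_vectors)

lemma lattice_path_bases_eq:
  assumes "k \<le> n"
  shows "lattice_path_bases n k L U = {A. A \<subseteq> {1..n} \<and> card A = k \<and>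
    (\<forall>m\<in>{1..n}. card (north_steps L \<inter> {1..m}) \<le> card (A \<inter> {1..m}) \<and>
                card (A \<inter> {1..m}) \<le> card (north_steps U \<inter> {1..m}))}" (is "_ = ?R")
proof
  show "lattice_path_bases n k L U \<subseteq> ?R"
    using north_steps_subset
    by (force simp: lattice_path_bases_def lattice_paths_iff[OF assms] lies_below_def)
  show "?R \<subseteq> lattice_path_bases n k L U"
  proof
    fix A assume A: "A \<in> ?R"
    define P where "P = map (\<lambda>i. if Suc i \<in> A then North else East) [0..<n]"
    have "north_steps P = A"
    proof (intro set_eqI)
      fix x
      show "x \<in> north_steps P \<longleftrightarrow> x \<in> A"
      proof (cases "x \<in> {1..n}")
        case True
        then have "P ! (x - 1) = (if x \<in> A then North else East)"
          by (cases x) (simp_all add: P_def)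
        then show ?thesis using True by (simp add: north_steps_def P_def)
      next
        case False
        then show ?thesis using A by (auto simp: north_steps_def P_def)
      qed
    qed
    moreover have "length P = n"
      by (simp add: P_def)
    ultimately show "A \<in> lattice_path_bases n k L U"
      using A by (auto simp: lattice_path_bases_def lattice_paths_iff[OF assms] lies_below_def
          intro!: image_eqI[of _ _ P])
  qed
qed

lemma card_Int_Suc:
  "card (A \<inter> {1..Suc m}) = card (A \<inter> {1..m}) + of_bool (Suc m \<in> A)"
proof -
  have "A \<inter> {1..Suc m} = (if Suc m \<in> A then insert (Suc m) (A \<inter> {1..m}) else A \<inter> {1..m})"
    by (auto simp: le_Suc_eq)
  then show ?thesis by simp
qed

lemma card_exchange_Int:
  assumes "x \<in> A" "y \<notin> A" "1 \<le> x" "1 \<le> y"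
  shows "int (card (insert y (A - {x}) \<inter> {1..m})) =
    int (card (A \<inter> {1..m})) + of_bool (y \<le> m) - of_bool (x \<le> (m::nat))"
proof (induction m)
  case 0
  then show ?case using assms by auto
next
  case (Suc m)
  then show ?case using assms unfolding card_Int_Suc by (auto simp: of_bool_def le_Suc_eq)
qed

theorem is_matroid_lattice_path_matroid:
  assumes "k \<le> n" "L \<in> lattice_paths n k" "U \<in> lattice_paths n k" "lies_below n L U"
  shows "is_matroid (lattice_path_matroid n k L U)"
    and "B \<in> bases (lattice_path_matroid n k L U) \<Longrightarrow> card B = k"
proof -
  note eq = lattice_path_bases_eq[OF assms(1), of L U]
  have "north_steps L \<in> lattice_path_bases n k L U"
    using assms by (auto simp: lattice_path_bases_def lies_below_def)
  moreover have "\<exists>y\<in>B - A. insert y (A - {x}) \<in> lattice_path_bases n k L U"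
    if A: "A \<in> lattice_path_bases n k L U" and B: "B \<in> lattice_path_bases n k L U"
      and x: "x \<in> A - B" for A B x
  proof -
    define h where "h = (\<lambda>(C::nat set) m. card (C \<inter> {1..m}))"
    have h_Suc: "h C (Suc m) = h C m + of_bool (Suc m \<in> C)" for C m
      unfolding h_def by (rule card_Int_Suc)
    have h0: "h C 0 = 0" for C by (simp add: h_def)
    have hn: "h A n = h B n"
      using A B by (auto simp: eq h_def Int_absorb2)
    have xn: "1 \<le> x" "x \<le> n" using x A by (auto simp: eq)
    have ha: "h (north_steps L) m \<le> h C m \<and> h C m \<le> h (north_steps U) m"
      if "1 \<le> m" "m \<le> n" "C \<in> lattice_path_bases n k L U" for C m
      using that by (auto simp: eq h_def)
    have key: ?thesis
      if y: "y \<in> B" "y \<notin> A"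
        and up: "\<And>m. y \<le> m \<Longrightarrow> m < x \<Longrightarrow> h A m < h B m"
        and down: "\<And>m. x \<le> m \<Longrightarrow> m < y \<Longrightarrow> h B m < h A m" for y
    proof -
      let ?A = "insert y (A - {x})"
      have yn: "1 \<le> y" "y \<le> n" using y B by (auto simp: eq)
      have hA: "int (h ?A m) = int (h A m) + of_bool (y \<le> m) - of_bool (x \<le> m)" for m
        using card_exchange_Int[of x A y m] x y xn yn by (simp add: h_def)
      have sub: "?A \<subseteq> {1..n}" using A yn by (auto simp: eq)
      have "card ?A = h ?A n" using sub by (simp add: h_def Int_absorb2)
      also have "\<dots> = h A n" using hA[of n] xn yn by simp
      also have "\<dots> = k" using A by (auto simp: eq h_def Int_absorb2)
      finally have "card ?A = k" .
      moreover have "h (north_steps L) m \<le> h ?A m \<and> h ?A m \<le> h (north_steps U) m"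
        if m: "1 \<le> m" "m \<le> n" for m
        using hA[of m] ha[OF m A] ha[OF m B] up[of m] down[of m]
        by (cases "y \<le> m"; cases "x \<le> m") auto
      ultimately have "?A \<in> lattice_path_bases n k L U"
        using sub by (auto simp: eq h_def)
      with y show ?thesis by blast
    qed
    show ?thesis
    proof (cases "h B x < h A x")
      case True
      define y where "y = (LEAST m. x < m \<and> h A m \<le> h B m)"
      have "x < n" using True hn xn by (cases "x = n") auto
      then have ex: "x < n \<and> h A n \<le> h B n" using hn by simp
      have y1: "x < y" "h A y \<le> h B y"
        using LeastI[of "\<lambda>m. x < m \<and> h A m \<le> h B m", OF ex] by (auto simp: y_def)
      have lt: "h B m < h A m" if "x \<le> m" "m < y" for m
        using not_less_Least[of m "\<lambda>m. x < m \<and> h A m \<le> h B m"] that True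
        by (cases "m = x") (auto simp: y_def)
      obtain z where z: "y = Suc z" using y1 by (cases y) auto
      have "h B z < h A z" using lt[of z] y1 z by simp
      then have "y \<in> B" "y \<notin> A"
        using y1 h_Suc[of A z] h_Suc[of B z] by (auto simp: z of_bool_def split: if_splits)
      then show ?thesis
        using key[of y] lt y1 by auto
    next
      case False
      obtain w where w: "x = Suc w" using xn by (cases x) auto
      have Bw: "h A w < h B w"
        using False h_Suc[of A w] h_Suc[of B w] x by (auto simp: w)
      define z where "z = (GREATEST m. m < x \<and> h B m \<le> h A m)"
      have ex: "0 < x \<and> h B 0 \<le> h A 0" using xn by (simp add: h0)
      have z1: "z < x" "h B z \<le> h A z"
        using GreatestI_nat[of "\<lambda>m. m < x \<and> h B m \<le> h A m", OF ex, of x] by (auto simp: z_def)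
      have lt: "h A m < h B m" if "z < m" "m < x" for m
        using Greatest_le_nat[of "\<lambda>m. m < x \<and> h B m \<le> h A m" m x] that
        by (force simp: z_def)
      have "z \<noteq> w" using Bw z1 by auto
      then have "Suc z < x" using z1 w by simp
      then have "Suc z \<in> B" "Suc z \<notin> A"
        using z1 lt[of "Suc z"] h_Suc[of A z] h_Suc[of B z] by (auto simp: of_bool_def split: if_splits)
      then show ?thesis
        using key[of "Suc z"] lt \<open>Suc z < x\<close> by auto
    qed
  qed
  moreover have "A \<subseteq> {1..n}" if "A \<in> lattice_path_bases n k L U" for A
    using that by (auto simp: eq)
  ultimately show "is_matroid (lattice_path_matroid n k L U)"
    unfolding is_matroid_def lattice_path_matroid_def by auto
  show "B \<in> bases (lattice_path_matroid n k L U) \<Longrightarrow> card B = k"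
    by (auto simp: lattice_path_matroid_def eq)
qed

end

theory Submission
  imports Defs
begin

text \<open>Why the coefficients are nonnegative.

  Passing to partial sums, the integer points of the \<open>m\<close>-th dilate of the base polytope become the
  height functions \<open>y\<close> with steps in \<open>{0..m}\<close> that stay between \<open>m\<close> times the heights of \<open>L\<close> and
  of \<open>U\<close> (\<open>bij_betw_increments\<close>; a point is a sum of \<open>m\<close> vertices because \<open>y\<close> is the sum of the
  height functions \<open>\<lfloor>(y + i) / m\<rfloor>\<close> with \<open>i < m\<close>).  Write \<open>y = m a + r\<close> with \<open>0 \<le> r < m\<close>.  The
  quotient \<open>a\<close> is the height function of a single lattice path between \<open>L\<close> and \<open>U\<close>, and \<open>r\<close> is zero
  where \<open>a\<close> touches \<open>U\<close>; elsewhere \<open>r j \<le> r (j + 1)\<close> if the path goes east at this step, and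
  \<open>r (j + 1) \<le> r j\<close> if it goes north.  Hence the Ehrhart polynomial is the sum, over all
  paths \<open>a\<close>, of the order polynomials of fences (zigzag posets) (\<open>card_corridor\<close>).

  It remains to see that the order polynomial \<open>\<Omega>\<^sub>V\<close> of a fence \<open>V\<close> has nonnegative coefficients
  (\<open>fence_poly_nonneg\<close>).  Cutting the values of an order preserving map at \<open>s\<close> gives
  \<open>\<Omega>\<^sub>V (s + t) = (\<Sum>I. \<Omega>\<^sub>I s * \<Omega>\<^bsub>V - I\<^esub> t)\<close>, the sum running over the order ideals of \<open>V\<close>.  Comparing linear
  terms in \<open>s\<close>, the derivative of \<open>\<Omega>\<^sub>V\<close> is a combination of the \<open>\<Omega>\<^bsub>V - I\<^esub>\<close>, whose coefficients are the linear
  coefficients of the \<open>\<Omega>\<^sub>I\<close>.  So it suffices that linear coefficients are nonnegative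
  (\<open>fence_linear_coeff\<close>).  A disconnected fence has linear coefficient \<open>0\<close>, its order polynomial being
  a product of two polynomials without constant term.  For the same reason, replacing one
  relation \<open>\<ge>\<close> of a connected fence by its negation \<open><\<close> only changes the sign of the linear
  coefficient.  Doing so for all \<open>\<ge>\<close> leaves a chain with, say, \<open>d\<close> strict relations on \<open>p\<close> elements,
  which has \<open>m + p - 1 - d\<close> choose \<open>p\<close> maps into \<open>{..<m}\<close>, and the linear coefficient of this polynomial in \<open>m\<close>
  has the sign \<open>(-1)\<^sup>d\<close>.\<close>

section \<open>Polynomials and their linear coefficients\<close>

lemma poly_eqI_of_nat:
  fixes p q :: "rat poly"
  assumes "\<And>m::nat. poly p (of_nat m) = poly q (of_nat m)"
  shows "p = q"
proof (rule ccontr)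
  assume "p \<noteq> q"
  then have "finite {x. poly (p - q) x = 0}"
    by (intro poly_roots_finite) simp
  moreover have "range of_nat \<subseteq> {x. poly (p - q) x = 0}"
    using assms by auto
  ultimately have "finite (range (of_nat :: nat \<Rightarrow> rat))"
    using finite_subset by blast
  then show False
    by (simp add: finite_image_iff inj_of_nat)
qed

lemma coeff_1_pcompose_shift: "coeff (pcompose p [:t, 1:]) 1 = poly (pderiv p) (t :: rat)"
proof -
  have "coeff (pcompose p [:t, 1:]) 1 = poly (pderiv (pcompose p [:t, 1:])) 0"
    by (simp add: poly_0_coeff_0 coeff_pderiv)
  also have "\<dots> = poly (pderiv p) t"
    by (simp add: pderiv_pcompose poly_pcompose pderiv_pCons)
  finally show ?thesis .
qed

lemma coeff_1_mult_zero:
  fixes p q :: "rat poly"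
  assumes "coeff p 0 = 0" "coeff q 0 = 0"
  shows "coeff (p * q) 1 = 0"
  using assms by (simp add: coeff_mult)

text \<open>Seen as a polynomial in \<open>m\<close>, the binomial coefficient \<open>m + c\<close> choose \<open>p\<close> with \<open>c < p\<close> has exactly
  one factor \<open>m + c - i\<close> vanishing at \<open>0\<close>; its linear coefficient is the product of the constant
  terms of the others, of which the \<open>d = p - 1 - c\<close> factors with \<open>i > c\<close> are negative, divided by \<open>fact p\<close>.\<close>

lemma binomial_poly_linear_coeff:
  assumes "c + d + 1 = p"
  shows "\<exists>q :: rat poly. (\<forall>m::nat. poly q (of_nat m) = of_nat ((m + c) choose p)) \<and>
    coeff q 0 = 0 \<and> 0 \<le> (-1) ^ d * coeff q 1"
proof -
  define R :: "rat poly" where "R = (\<Prod>i\<in>{..<p} - {c}. [:of_nat c - of_nat i, 1:])"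
  define q :: "rat poly" where "q = smult (1 / fact p) (\<Prod>i<p. [:of_nat c - of_nat i, 1:])"
  have poly_q: "poly q (of_nat m) = of_nat ((m + c) choose p)" for m :: nat
    by (simp add: q_def poly_prod binomial_gbinomial gbinomial_prod_rev atLeast0LessThan algebra_simps)
  have "(\<Prod>i<p. [:of_nat c - of_nat i, 1:]) = ([:0, 1:] :: rat poly) * R"
    using assms unfolding R_def by (subst prod.remove[of _ c]) auto
  then have q: "q = smult (1 / fact p) (pCons 0 R)"
    by (simp add: q_def)
  have split: "{..<p} - {c} = {..<c} \<union> {c<..<p}"
    using assms by auto
  have "coeff R 0 = (\<Prod>i\<in>{..<p} - {c}. of_nat c - of_nat i)"
    by (simp add: R_def poly_0_coeff_0 [symmetric] poly_prod)
  also have "\<dots> = (\<Prod>i<c. of_nat c - of_nat i) * (\<Prod>i\<in>{c<..<p}. of_nat c - of_nat i)"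
    unfolding split by (rule prod.union_disjoint) auto
  also have "(\<Prod>i\<in>{c<..<p}. of_nat c - of_nat i :: rat) = (-1) ^ d * (\<Prod>i\<in>{c<..<p}. of_nat i - of_nat c)"
  proof -
    have "(\<Prod>i\<in>{c<..<p}. of_nat c - of_nat i :: rat) = (\<Prod>i\<in>{c<..<p}. (-1) * (of_nat i - of_nat c))"
      by (intro prod.cong) auto
    also have "\<dots> = (-1) ^ card {c<..<p} * (\<Prod>i\<in>{c<..<p}. of_nat i - of_nat c)"
      by (simp only: prod.distrib prod_constant)
    also have "card {c<..<p} = d" using assms by auto
    finally show ?thesis .
  qed
  finally have "(-1) ^ d * coeff R 0 =
      ((-1) ^ d * (-1) ^ d) * ((\<Prod>i<c. of_nat c - of_nat i) * (\<Prod>i\<in>{c<..<p}. of_nat i - of_nat c))"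
    by (simp add: mult_ac)
  moreover have "(-1) ^ d * (-1) ^ d = (1 :: rat)"
    by (simp add: power_add [symmetric])
  moreover have "0 \<le> (\<Prod>i<c. of_nat c - of_nat i :: rat)" "0 \<le> (\<Prod>i\<in>{c<..<p}. of_nat i - of_nat c :: rat)"
    by (auto intro!: prod_nonneg)
  ultimately have "0 \<le> (-1) ^ d * coeff R 0"
    by simp
  then have "0 \<le> (-1) ^ d * coeff q 1"
    by (simp add: q zero_le_divide_iff)
  moreover have "coeff q 0 = 0" by (simp add: q)
  ultimately show ?thesis using poly_q by blast
qed

section \<open>Fence maps and their splittings\<close>

text \<open>The maps from \<open>V\<close> to \<open>{..<m}\<close> whose values at adjacent elements \<open>j\<close> and \<open>j + 1\<close> of \<open>V\<close> are related
  by \<open>R j\<close>.  Nothing is required across gaps of \<open>V\<close>.  The maps are undefined outside \<open>V\<close>, so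
  that they can be counted; in particular there is exactly one for empty \<open>V\<close>.\<close>

definition rel_maps :: "(nat \<Rightarrow> nat \<Rightarrow> nat \<Rightarrow> bool) \<Rightarrow> nat set \<Rightarrow> nat \<Rightarrow> (nat \<Rightarrow> nat) set" where
  "rel_maps R V m = {r \<in> V \<rightarrow>\<^sub>E {..<m}. \<forall>j. j \<in> V \<longrightarrow> Suc j \<in> V \<longrightarrow> R j (r j) (r (Suc j))}"

lemma finite_rel_maps: "finite V \<Longrightarrow> finite (rel_maps R V m)"
  unfolding rel_maps_def by (simp add: finite_PiE)

lemma rel_maps_empty [simp]: "rel_maps R {} m = {\<lambda>_. undefined}"
  by (auto simp: rel_maps_def)

lemma rel_maps_zero: "V \<noteq> {} \<Longrightarrow> rel_maps R V 0 = {}"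
  by (auto simp: rel_maps_def PiE_def)

lemma rel_maps_cong:
  assumes "\<And>j. j \<in> V \<Longrightarrow> Suc j \<in> V \<Longrightarrow> R j = R' j"
  shows "rel_maps R V m = rel_maps R' V m"
  using assms by (auto simp: rel_maps_def)

lemma mem_rel_maps_iff_upd:
  assumes "j \<in> V" "Suc j \<in> V" "\<And>i. i \<noteq> j \<Longrightarrow> R' i = R i"
  shows "r \<in> rel_maps R' V m \<longleftrightarrow>
    r \<in> rel_maps (R(j := \<lambda>_ _. True)) V m \<and> R' j (r j) (r (Suc j))"
proof -
  have "(\<forall>i. i \<in> V \<longrightarrow> Suc i \<in> V \<longrightarrow> R' i (r i) (r (Suc i))) \<longleftrightarrow>
      (\<forall>i. i \<in> V \<longrightarrow> Suc i \<in> V \<longrightarrow> (R(j := \<lambda>_ _. True)) i (r i) (r (Suc i))) \<and>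
      R' j (r j) (r (Suc j))"
    using assms by (metis fun_upd_apply)
  then show ?thesis by (simp add: rel_maps_def conj_ac)
qed

text \<open>Multiplicativity, also when some elements of \<open>A\<close> and \<open>B\<close> are adjacent, provided that the
  relation there is trivial.\<close>

lemma card_rel_maps_Un:
  assumes "A \<inter> B = {}"
    and "\<And>j x y. j \<in> A \<and> Suc j \<in> B \<or> j \<in> B \<and> Suc j \<in> A \<Longrightarrow> R j x y"
  shows "card (rel_maps R (A \<union> B) m) = card (rel_maps R A m) * card (rel_maps R B m)"
proof -
  have "bij_betw (\<lambda>r. (restrict r A, restrict r B)) (rel_maps R (A \<union> B) m)
      (rel_maps R A m \<times> rel_maps R B m)"
  proof (rule bij_betw_byWitness[where f' = "\<lambda>(f, g) x. if x \<in> A then f x else g x"])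
    show "\<forall>r\<in>rel_maps R (A \<union> B) m.
        (\<lambda>(f, g) x. if x \<in> A then f x else g x) (restrict r A, restrict r B) = r"
      by (auto simp: rel_maps_def fun_eq_iff PiE_def extensional_def)
    show "\<forall>fg\<in>rel_maps R A m \<times> rel_maps R B m.
        (restrict ((\<lambda>(f, g) x. if x \<in> A then f x else g x) fg) A,
         restrict ((\<lambda>(f, g) x. if x \<in> A then f x else g x) fg) B) = fg"
      using assms(1) by (auto simp: rel_maps_def fun_eq_iff PiE_def extensional_def)
    show "(\<lambda>r. (restrict r A, restrict r B)) ` rel_maps R (A \<union> B) m
        \<subseteq> rel_maps R A m \<times> rel_maps R B m"
      by (auto simp: rel_maps_def PiE_def)
    show "(\<lambda>(f, g) x. if x \<in> A then f x else g x) ` (rel_maps R A m \<times> rel_maps R B m)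
        \<subseteq> rel_maps R (A \<union> B) m"
      using assms by (auto simp: rel_maps_def PiE_def Pi_def extensional_def)
  qed
  then show ?thesis
    by (simp add: bij_betw_same_card card_cartesian_product)
qed

text \<open>The relation between the values at \<open>j\<close> and \<open>j + 1\<close> is \<open>\<ge>\<close> for \<open>j\<close> in \<open>D\<close>, and otherwise \<open><\<close> or \<open>\<le>\<close>
  according to whether \<open>j\<close> is in \<open>S\<close>.  Moving an index from \<open>D\<close> to \<open>S\<close> negates its relation.\<close>

definition fence_rel :: "nat set \<Rightarrow> nat set \<Rightarrow> nat \<Rightarrow> nat \<Rightarrow> nat \<Rightarrow> bool" where
  "fence_rel D S j x y = (if j \<in> D then y \<le> x else if j \<in> S then x < y else x \<le> y)"

text \<open>Without strict relations, these are the order preserving maps on the fence \<open>V\<close> with descents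
  at \<open>D\<close>; their number as a function of \<open>m\<close> is the order polynomial of the fence.\<close>

abbreviation fence_maps :: "nat set \<Rightarrow> nat set \<Rightarrow> nat \<Rightarrow> (nat \<Rightarrow> nat) set" where
  "fence_maps D \<equiv> rel_maps (fence_rel D {})"

lemma sum_choose_shift:
  assumes "c \<le> p"
  shows "(\<Sum>v<m. (v + c) choose p) = (m + c) choose Suc p"
  using assms by (induction m) (simp_all add: binomial_eq_0)

text \<open>Without descents the values increase along \<open>{a..b}\<close>, so the last value \<open>v\<close> bounds
  all others: they range over \<open>{..<v}\<close> or \<open>{..v}\<close>, depending on whether the last relation is strict.
  This gives a recursion that is solved by the hockey-stick identity.\<close>

lemma card_chain_maps:
  assumes "a \<le> b" "D \<inter> {a..<b} = {}"
  shows "card (rel_maps (fence_rel D S) {a..b} m) =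
    (m + (b - a - card (S \<inter> {a..<b}))) choose Suc (b - a)"
  using assms
proof (induction b arbitrary: m rule: dec_induct)
  case base
  have "rel_maps (fence_rel D S) {a..a} m = {a} \<rightarrow>\<^sub>E {..<m}"
    by (auto simp: rel_maps_def)
  then show ?case by (simp add: card_PiE)
next
  case (step b)
  let ?R = "fence_rel D S"
  let ?d = "card (S \<inter> {a..<b})"
  \<comment> \<open>the bound on the values at \<open>{a..b}\<close> when the value at \<open>b + 1\<close> is \<open>v\<close>\<close>
  define B where "B v = (if b \<in> S then v else Suc v)" for v :: nat
  have D: "D \<inter> {a..<b} = {}" and b: "b \<notin> D" using step by auto
  have Rb: "?R b x y \<longleftrightarrow> x < B y" for x y
    using b by (auto simp: fence_rel_def B_def)
  have mono: "r i \<le> r b" if r: "r \<in> rel_maps ?R {a..b} m" and i: "a \<le> i" "i \<le> b" for r i m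
    using i(2,1)
  proof (induction i rule: inc_induct)
    case base
    then show ?case by simp
  next
    case (step i)
    then have "i \<notin> D" "?R i (r i) (r (Suc i))"
      using r D by (auto simp: rel_maps_def)
    then have "r i \<le> r (Suc i)"
      by (auto simp: fence_rel_def split: if_splits)
    with step show ?case by simp
  qed
  let ?f = "\<lambda>r. (r (Suc b), restrict r {a..b})"
  have "bij_betw ?f (rel_maps ?R {a..Suc b} m) (SIGMA v:{..<m}. rel_maps ?R {a..b} (B v))"
  proof (rule bij_betw_byWitness[where f' = "\<lambda>(v, r). r(Suc b := v)"])
    show "\<forall>r\<in>rel_maps ?R {a..Suc b} m. (\<lambda>(v, r). r(Suc b := v)) (?f r) = r"
      by (auto simp: rel_maps_def fun_eq_iff PiE_def extensional_def)
    show "\<forall>vr\<in>(SIGMA v:{..<m}. rel_maps ?R {a..b} (B v)). ?f ((\<lambda>(v, r). r(Suc b := v)) vr) = vr"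
      by (auto simp: rel_maps_def fun_eq_iff PiE_def extensional_def)
    show "?f ` rel_maps ?R {a..Suc b} m \<subseteq> (SIGMA v:{..<m}. rel_maps ?R {a..b} (B v))"
    proof (rule image_subsetI)
      fix r assume r: "r \<in> rel_maps ?R {a..Suc b} m"
      then have r': "restrict r {a..b} \<in> rel_maps ?R {a..b} m"
        by (auto simp: rel_maps_def)
      have "r b < B (r (Suc b))"
        using r step.hyps Rb[of "r b" "r (Suc b)"] by (auto simp: rel_maps_def)
      moreover have "r i \<le> r b" if "a \<le> i" "i \<le> b" for i
        using mono[OF r', of i] that step.hyps by simp
      ultimately have "r i < B (r (Suc b))" if "a \<le> i" "i \<le> b" for i
        using that le_less_trans by blast
      then show "?f r \<in> (SIGMA v:{..<m}. rel_maps ?R {a..b} (B v))"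
        using r step.hyps by (auto simp: rel_maps_def)
    qed
    show "(\<lambda>(v, r). r(Suc b := v)) ` (SIGMA v:{..<m}. rel_maps ?R {a..b} (B v))
        \<subseteq> rel_maps ?R {a..Suc b} m"
    proof clarify
      fix v r assume v: "v < m" and r: "r \<in> rel_maps ?R {a..b} (B v)"
      have "B v \<le> m" using v by (simp add: B_def)
      then have "r i < m" if "a \<le> i" "i \<le> b" for i
        using r that less_le_trans[of "r i" "B v" m] by (auto simp: rel_maps_def PiE_iff)
      moreover have "r b < B v" using r step.hyps by (auto simp: rel_maps_def)
      ultimately show "r(Suc b := v) \<in> rel_maps ?R {a..Suc b} m"
        using v r step.hyps
        by (auto simp: rel_maps_def PiE_def extensional_def Rb le_Suc_eq)
    qed
  qed
  then have "card (rel_maps ?R {a..Suc b} m) = (\<Sum>v<m. card (rel_maps ?R {a..b} (B v)))"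
    by (simp add: bij_betw_same_card finite_rel_maps)
  also have "\<dots> = (\<Sum>v<m. (B v + (b - a - ?d)) choose Suc (b - a))"
    using step.IH D by simp
  also have "\<dots> = (m + (Suc b - a - card (S \<inter> {a..<Suc b}))) choose Suc (Suc b - a)"
  proof -
    have d: "?d \<le> b - a"
      using card_mono[of "{a..<b}" "S \<inter> {a..<b}"] by simp
    have S: "S \<inter> {a..<Suc b} = (if b \<in> S then insert b (S \<inter> {a..<b}) else S \<inter> {a..<b})"
      using step.hyps by (auto simp: less_Suc_eq)
    show ?thesis
    proof (cases "b \<in> S")
      case True
      then show ?thesis
        using sum_choose_shift[of "b - a - ?d" "Suc (b - a)" m] S step.hyps
        by (simp add: B_def Suc_diff_le)
    next
      case False
      then show ?thesis
        using sum_choose_shift[of "Suc (b - a - ?d)" "Suc (b - a)" m] S step.hyps d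
        by (simp add: B_def Suc_diff_le)
    qed
  qed
  finally show ?case .
qed

section \<open>Linear coefficients of fences\<close>

text \<open>Induction on the number of descents: negating one of them removes it at the cost of a sign,
  up to the product of the polynomials of the two parts, which has no linear term.\<close>

lemma interval_linear_coeff:
  assumes "a \<le> b" "D \<inter> S = {}"
  shows "\<exists>q :: rat poly. (\<forall>m::nat. poly q (of_nat m) = of_nat (card (rel_maps (fence_rel D S) {a..b} m))) \<and>
    coeff q 0 = 0 \<and> 0 \<le> (-1) ^ card (S \<inter> {a..<b}) * coeff q 1"
  using assms
proof (induction "card (D \<inter> {a..<b})" arbitrary: a b D S rule: less_induct)
  case less
  show ?case
  proof (cases "D \<inter> {a..<b} = {}")
    case True
    have "card (S \<inter> {a..<b}) \<le> b - a"
      using card_mono[of "{a..<b}" "S \<inter> {a..<b}"] by simp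
    then show ?thesis
      using binomial_poly_linear_coeff[of "b - a - card (S \<inter> {a..<b})" "card (S \<inter> {a..<b})" "Suc (b - a)"]
        card_chain_maps[OF less.prems(1) True] by simp
  next
    case False
    then obtain j where j: "j \<in> D" "a \<le> j" "j < b" by auto
    let ?D = "D - {j}" and ?S = "insert j S"
    let ?R = "fence_rel D S" and ?R' = "fence_rel ?D ?S"
    have smaller: "card (D' \<inter> {a'..<b'}) < card (D \<inter> {a..<b})"
      if "D' \<inter> {a'..<b'} \<subseteq> D \<inter> {a..<b} - {j}" for D' a' b'
      using j that by (intro psubset_card_mono) auto
    have s1: "D \<inter> {a..<j} \<subseteq> D \<inter> {a..<b} - {j}" and s2: "D \<inter> {Suc j..<b} \<subseteq> D \<inter> {a..<b} - {j}"
      using j by auto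
    obtain q1 where q1: "\<And>m::nat. poly q1 (of_nat m) = (of_nat (card (rel_maps ?R {a..j} m)) :: rat)"
      "coeff q1 0 = 0"
      using less.hyps[of D a j S] smaller[OF s1] j less.prems by auto
    obtain q2 where q2: "\<And>m::nat. poly q2 (of_nat m) = (of_nat (card (rel_maps ?R {Suc j..b} m)) :: rat)"
      "coeff q2 0 = 0"
      using less.hyps[of D "Suc j" b S] smaller[OF s2] j less.prems by auto
    have "?D \<inter> ?S = {}" using less.prems by auto
    then obtain q3 where q3: "\<And>m::nat. poly q3 (of_nat m) = (of_nat (card (rel_maps ?R' {a..b} m)) :: rat)"
      "coeff q3 0 = 0" "0 \<le> (-1) ^ card (?S \<inter> {a..<b}) * coeff q3 1"
      using less.hyps[of ?D a b ?S] smaller[of ?D a b] less.prems by auto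
    have "card (rel_maps ?R {a..b} m) + card (rel_maps ?R' {a..b} m) =
        card (rel_maps ?R {a..j} m) * card (rel_maps ?R {Suc j..b} m)" for m
    proof -
      let ?T = "?R(j := \<lambda>_ _. True)"
      have ab: "{a..b} = {a..j} \<union> {Suc j..b}" using j by auto
      have jV: "j \<in> {a..b}" "Suc j \<in> {a..b}" using j by auto
      have R: "r \<in> rel_maps ?R {a..b} m \<longleftrightarrow>
          r \<in> rel_maps ?T {a..b} m \<and> ?R j (r j) (r (Suc j))" for r
        by (rule mem_rel_maps_iff_upd[OF jV]) simp
      have R': "r \<in> rel_maps ?R' {a..b} m \<longleftrightarrow>
          r \<in> rel_maps ?T {a..b} m \<and> ?R' j (r j) (r (Suc j))" for r
        by (rule mem_rel_maps_iff_upd[OF jV]) (simp add: fence_rel_def fun_eq_iff)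
      have "?R' j x y \<longleftrightarrow> \<not> ?R j x y" for x y
        using j(1) by (simp add: fence_rel_def not_le)
      then have "rel_maps ?T {a..b} m = rel_maps ?R {a..b} m \<union> rel_maps ?R' {a..b} m"
        and "rel_maps ?R {a..b} m \<inter> rel_maps ?R' {a..b} m = {}"
        unfolding set_eq_iff Un_iff Int_iff R R' by blast+
      then have "card (rel_maps ?R {a..b} m) + card (rel_maps ?R' {a..b} m) = card (rel_maps ?T {a..b} m)"
        by (simp add: card_Un_disjoint finite_rel_maps)
      also have "\<dots> = card (rel_maps ?T {a..j} m) * card (rel_maps ?T {Suc j..b} m)"
        unfolding ab by (rule card_rel_maps_Un) auto
      also have "rel_maps ?T {a..j} m = rel_maps ?R {a..j} m"
        by (rule rel_maps_cong) auto
      also have "rel_maps ?T {Suc j..b} m = rel_maps ?R {Suc j..b} m"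
        by (rule rel_maps_cong) auto
      finally show ?thesis .
    qed
    then have "of_nat (card (rel_maps ?R {a..b} m)) + (of_nat (card (rel_maps ?R' {a..b} m)) :: rat) =
        of_nat (card (rel_maps ?R {a..j} m)) * of_nat (card (rel_maps ?R {Suc j..b} m))" for m
      by (metis of_nat_add of_nat_mult)
    then have "poly (q1 * q2 - q3) (of_nat m) = of_nat (card (rel_maps ?R {a..b} m))" for m
      by (simp add: q1 q2 q3) (metis add_diff_cancel_right')
    moreover have "coeff (q1 * q2 - q3) 0 = 0"
      using q1 q2 q3 by (simp add: coeff_mult)
    moreover have "0 \<le> (-1) ^ card (S \<inter> {a..<b}) * coeff (q1 * q2 - q3) 1"
    proof -
      have "?S \<inter> {a..<b} = insert j (S \<inter> {a..<b})" "j \<notin> S" using j less.prems by auto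
      then show ?thesis
        using coeff_1_mult_zero[OF q1(2) q2(2)] q3(3) by simp
    qed
    ultimately show ?thesis by blast
  qed
qed

lemma fence_linear_coeff:
  assumes "finite V" "V \<noteq> {}"
  shows "\<exists>q :: rat poly. (\<forall>m::nat. poly q (of_nat m) = of_nat (card (fence_maps D V m))) \<and>
    coeff q 0 = 0 \<and> 0 \<le> coeff q 1"
  using assms
proof (induction "card V" arbitrary: V rule: less_induct)
  case less
  define a where "a = Min V"
  define b where "b = Max V"
  have ab: "a \<in> V" "b \<in> V" "V \<subseteq> {a..b}" 
    using less.prems by (auto simp: a_def b_def)
  show ?case
  proof (cases "V = {a..b}")
    case True
    then show ?thesis
      using interval_linear_coeff[of a b D "{}"] ab by auto
  next
    case False
    then obtain j where j: "j \<notin> V" "a < j" "j < b"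
      using ab by (metis atLeastAtMost_iff le_neq_implies_less subsetI subset_antisym)
    let ?A = "V \<inter> {..<j}" and ?B = "V \<inter> {j<..}"
    have "x < j \<or> j < x" if "x \<in> V" for x
      using j(1) that by (metis nat_neq_iff)
    then have V: "V = ?A \<union> ?B" by blast
    have "b \<notin> ?A" "a \<notin> ?B" using j(2,3) by auto
    then have "?A \<subset> V" "?B \<subset> V"
      using ab(1,2) by blast+
    then have "card ?A < card V" "card ?B < card V"
      using less.prems(1) by (simp_all add: psubset_card_mono)
    moreover have "?A \<noteq> {}" "?B \<noteq> {}" using ab(1,2) j(2,3) by auto
    ultimately obtain q1 q2 where
      q1: "\<And>m::nat. poly q1 (of_nat m) = (of_nat (card (fence_maps D ?A m)) :: rat)" "coeff q1 0 = 0" and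
      q2: "\<And>m::nat. poly q2 (of_nat m) = (of_nat (card (fence_maps D ?B m)) :: rat)" "coeff q2 0 = 0"
      using less.hyps[of ?A] less.hyps[of ?B] less.prems(1) by (metis finite_Int)
    have "card (fence_maps D (?A \<union> ?B) m) = card (fence_maps D ?A m) * card (fence_maps D ?B m)" for m
      using j by (intro card_rel_maps_Un) auto
    then have "poly (q1 * q2) (of_nat m) = of_nat (card (fence_maps D V m))" for m
      by (simp add: q1(1) q2(1) V [symmetric])
    moreover have "coeff (q1 * q2) 0 = 0" using q1 q2 by (simp add: coeff_mult)
    ultimately show ?thesis
      using coeff_1_mult_zero[OF q1(2) q2(2)] by (metis order_refl)
  qed
qed

section \<open>Positivity for fences\<close>

text \<open>The order ideals of the fence \<open>V\<close> with descents at \<open>D\<close>: subsets containing, along with an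
  element, every neighbour below it.\<close>

definition fence_ideals :: "nat set \<Rightarrow> nat set \<Rightarrow> nat set set" where
  "fence_ideals D V = {I. I \<subseteq> V \<and> (\<forall>j. j \<in> V \<longrightarrow> Suc j \<in> V \<longrightarrow>
     (if j \<in> D then j \<in> I \<longrightarrow> Suc j \<in> I else Suc j \<in> I \<longrightarrow> j \<in> I))}"

lemma finite_fence_ideals: "finite V \<Longrightarrow> finite (fence_ideals D V)"
  unfolding fence_ideals_def by (rule finite_subset[of _ "Pow V"]) (blast, simp)

text \<open>An order preserving map \<open>r\<close> to \<open>{..<s + t}\<close> is the same as an order ideal \<open>I\<close>, the set where
  \<open>r j < s\<close>, with order preserving maps \<open>I \<rightarrow> {..<s}\<close> and \<open>V - I \<rightarrow> {..<t}\<close>.\<close>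

lemma card_fence_maps_add:
  assumes "finite V"
  shows "card (fence_maps D V (s + t)) =
    (\<Sum>I\<in>fence_ideals D V. card (fence_maps D I s) * card (fence_maps D (V - I) t))"
proof -
  let ?f = "\<lambda>r. ({j \<in> V. r j < s}, restrict r {j \<in> V. r j < s},
    restrict (\<lambda>j. r j - s) {j \<in> V. \<not> r j < s})"
  let ?g = "\<lambda>(I, p, q) j. if j \<in> I then p j else if j \<in> V then q j + s else undefined"
  have "bij_betw ?f (fence_maps D V (s + t))
     (SIGMA I:fence_ideals D V. fence_maps D I s \<times> fence_maps D (V - I) t)"
  proof (rule bij_betw_byWitness[where f' = ?g])
    show "\<forall>r\<in>fence_maps D V (s + t). ?g (?f r) = r"
      by (auto simp: rel_maps_def PiE_def extensional_def fun_eq_iff)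
    show "\<forall>x\<in>(SIGMA I:fence_ideals D V. fence_maps D I s \<times> fence_maps D (V - I) t). ?f (?g x) = x"
    proof
      fix x assume "x \<in> (SIGMA I:fence_ideals D V. fence_maps D I s \<times> fence_maps D (V - I) t)"
      then obtain I p q where x: "x = (I, p, q)" and I: "I \<in> fence_ideals D V"
        and p: "p \<in> fence_maps D I s" and q: "q \<in> fence_maps D (V - I) t"
        by auto
      have "{j \<in> V. ?g (I, p, q) j < s} = I"
        using I p by (force simp: rel_maps_def fence_ideals_def)
      moreover have "{j \<in> V. \<not> ?g (I, p, q) j < s} = V - I"
        using I p by (force simp: rel_maps_def fence_ideals_def)
      moreover have "restrict (?g (I, p, q)) I = p"
        using p by (auto simp: rel_maps_def PiE_def extensional_def fun_eq_iff)
      moreover have "restrict (\<lambda>j. ?g (I, p, q) j - s) (V - I) = q"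
        using q by (auto simp: rel_maps_def PiE_def extensional_def fun_eq_iff)
      ultimately show "?f (?g x) = x" by (simp add: x)
    qed
    show "?f ` fence_maps D V (s + t) \<subseteq>
        (SIGMA I:fence_ideals D V. fence_maps D I s \<times> fence_maps D (V - I) t)"
    proof (rule image_subsetI)
      fix r assume r: "r \<in> fence_maps D V (s + t)"
      let ?I = "{j \<in> V. r j < s}"
      have rel: "fence_rel D {} j (r j) (r (Suc j))" if "j \<in> V" "Suc j \<in> V" for j
        using r that by (auto simp: rel_maps_def)
      have "?I \<in> fence_ideals D V"
        using rel by (force simp: fence_ideals_def fence_rel_def split: if_splits)
      moreover have "restrict r ?I \<in> fence_maps D ?I s"
        using rel by (auto simp: rel_maps_def)
      moreover have "restrict (\<lambda>j. r j - s) {j \<in> V. \<not> r j < s} \<in> fence_maps D (V - ?I) t"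
      proof -
        have "r j - s < t" if "j \<in> V" "\<not> r j < s" for j
          using r that by (auto simp: rel_maps_def PiE_iff)
        moreover have "fence_rel D {} j (r j - s) (r (Suc j) - s)" if "j \<in> V" "Suc j \<in> V" for j
          using rel[OF that] by (auto simp: fence_rel_def)
        ultimately show ?thesis by (auto simp: rel_maps_def PiE_iff extensional_def)
      qed
      ultimately show "?f r \<in> (SIGMA I:fence_ideals D V. fence_maps D I s \<times> fence_maps D (V - I) t)"
        by simp
    qed
    show "?g ` (SIGMA I:fence_ideals D V. fence_maps D I s \<times> fence_maps D (V - I) t)
        \<subseteq> fence_maps D V (s + t)"
    proof (rule image_subsetI)
      fix x assume "x \<in> (SIGMA I:fence_ideals D V. fence_maps D I s \<times> fence_maps D (V - I) t)"
      then obtain I p q where x: "x = (I, p, q)" and I: "I \<in> fence_ideals D V"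
        and p: "p \<in> fence_maps D I s" and q: "q \<in> fence_maps D (V - I) t"
        by auto
      let ?r = "?g (I, p, q)"
      have IV: "I \<subseteq> V" using I by (simp add: fence_ideals_def)
      have lt: "p j < s" if "j \<in> I" for j
        using p that by (auto simp: rel_maps_def)
      have "fence_rel D {} j (?r j) (?r (Suc j))" if j: "j \<in> V" "Suc j \<in> V" for j
      proof -
        have ideal: "if j \<in> D then j \<in> I \<longrightarrow> Suc j \<in> I else Suc j \<in> I \<longrightarrow> j \<in> I"
          using I j by (auto simp: fence_ideals_def)
        have "fence_rel D {} j (p j) (p (Suc j))" if "j \<in> I" "Suc j \<in> I"
          using p that by (auto simp: rel_maps_def)
        moreover have "fence_rel D {} j (q j) (q (Suc j))" if "j \<notin> I" "Suc j \<notin> I"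
          using q j that by (auto simp: rel_maps_def)
        ultimately show ?thesis
          using j ideal lt[of j] lt[of "Suc j"]
          by (cases "j \<in> I"; cases "Suc j \<in> I") (auto simp: fence_rel_def split: if_splits)
      qed
      moreover have "?r \<in> V \<rightarrow>\<^sub>E {..<s + t}"
        using IV lt q by (auto simp: rel_maps_def PiE_iff extensional_def trans_less_add1)
      ultimately show "?g x \<in> fence_maps D V (s + t)"
        by (simp add: x rel_maps_def)
    qed
  qed
  moreover have "finite I" if "I \<in> fence_ideals D V" for I
    using that assms finite_subset by (auto simp: fence_ideals_def)
  ultimately show ?thesis
    using assms by (simp add: bij_betw_same_card finite_fence_ideals finite_rel_maps card_cartesian_product)
qed

theorem fence_poly_nonneg:
  assumes "finite V"
  shows "\<exists>q :: rat poly. (\<forall>m::nat. poly q (of_nat m) = of_nat (card (fence_maps D V m))) \<and>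
    (\<forall>i. 0 \<le> coeff q i)"
proof -
  have "\<exists>q :: rat poly. (\<forall>m::nat. poly q (of_nat m) = of_nat (card (fence_maps D W m))) \<and>
      0 \<le> coeff q 1" if "finite W" for W
  proof (cases "W = {}")
    case True
    then show ?thesis by (intro exI[of _ 1]) simp
  next
    case False
    then show ?thesis using fence_linear_coeff[OF that] by blast
  qed
  then obtain P :: "nat set \<Rightarrow> rat poly" where
    P: "\<And>W (m::nat). finite W \<Longrightarrow> poly (P W) (of_nat m) = of_nat (card (fence_maps D W m))" and
    P1: "\<And>W. finite W \<Longrightarrow> 0 \<le> coeff (P W) 1"
    by metis
  have fin: "finite I" if "I \<in> fence_ideals D W" "finite W" for I W
    using that finite_subset by (auto simp: fence_ideals_def)
  have deriv: "pderiv (P W) = (\<Sum>I\<in>fence_ideals D W. smult (coeff (P I) 1) (P (W - I)))"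
    if W: "finite W" for W
  proof (rule poly_eqI_of_nat)
    fix t :: nat
    \<comment> \<open>The splitting identity with \<open>t\<close> fixed is an identity of polynomials in \<open>s\<close>; its linear
      coefficients in \<open>s\<close> give the derivative at \<open>t\<close>.\<close>
    have "pcompose (P W) [:of_nat t, 1:] = (\<Sum>I\<in>fence_ideals D W. smult (poly (P (W - I)) (of_nat t)) (P I))"
    proof (rule poly_eqI_of_nat)
      fix s :: nat
      have "poly (pcompose (P W) [:of_nat t, 1:]) (of_nat s) = poly (P W) (of_nat (s + t))"
        by (simp add: poly_pcompose add.commute)
      also have "\<dots> = of_nat (card (fence_maps D W (s + t)))"
        using P W by blast
      also have "\<dots> = (\<Sum>I\<in>fence_ideals D W. poly (P (W - I)) (of_nat t) * poly (P I) (of_nat s))"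
        unfolding card_fence_maps_add[OF W]
        by (simp add: P W fin mult.commute)
      finally show "poly (pcompose (P W) [:of_nat t, 1:]) (of_nat s) =
          poly (\<Sum>I\<in>fence_ideals D W. smult (poly (P (W - I)) (of_nat t)) (P I)) (of_nat s)"
        by (simp add: poly_sum)
    qed
    from arg_cong[OF this, of "\<lambda>p. coeff p 1"]
    show "poly (pderiv (P W)) (of_nat t) =
        poly (\<Sum>I\<in>fence_ideals D W. smult (coeff (P I) 1) (P (W - I))) (of_nat t)"
      unfolding coeff_1_pcompose_shift by (simp add: coeff_sum poly_sum mult.commute)
  qed
  have "0 \<le> coeff (P W) i" if "finite W" for W i
    using that
  proof (induction i arbitrary: W)
    case 0
    have "coeff (P W) 0 = of_nat (card (fence_maps D W 0))"
      using P[OF 0, of 0] by (simp add: poly_0_coeff_0)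
    then show ?case by simp
  next
    case (Suc i)
    have "of_nat (Suc i) * coeff (P W) (Suc i) = coeff (pderiv (P W)) i"
      by (simp add: coeff_pderiv)
    also have "\<dots> = (\<Sum>I\<in>fence_ideals D W. coeff (P I) 1 * coeff (P (W - I)) i)"
      by (simp add: deriv[OF Suc.prems] coeff_sum)
    also have "\<dots> \<ge> 0"
      using Suc.IH Suc.prems P1 fin by (intro sum_nonneg mult_nonneg_nonneg) auto
    finally show ?case
      by (simp add: zero_le_mult_iff del: of_nat_Suc)
  qed
  then show ?thesis using P assms by blast
qed


section \<open>Height functions in a corridor\<close>

text \<open>The height functions with steps between \<open>0\<close> and \<open>m\<close> lying between \<open>m\<close> times \<open>l\<close> and \<open>m\<close> times \<open>u\<close>.
  They live on all of the natural numbers, with no mention of the length of the paths: the values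
  are forced wherever \<open>l\<close> and \<open>u\<close> agree, as the heights of two lattice paths with the same ends do at \<open>0\<close>
  and past their last step.\<close>

definition corridor :: "(nat \<Rightarrow> nat) \<Rightarrow> (nat \<Rightarrow> nat) \<Rightarrow> nat \<Rightarrow> (nat \<Rightarrow> nat) set" where
  "corridor l u m = {y. \<forall>j. y j \<le> y (Suc j) \<and> y (Suc j) \<le> y j + m \<and> m * l j \<le> y j \<and> y j \<le> m * u j}"

lemma corridorD:
  assumes "y \<in> corridor l u m"
  shows "y j \<le> y (Suc j)" "y (Suc j) \<le> y j + m" "m * l j \<le> y j" "y j \<le> m * u j"
  using assms by (auto simp: corridor_def)

lemma finite_corridor:
  assumes "finite {j. l j \<noteq> u j}"
  shows "finite (corridor l u m)"
proof (rule inj_on_finite)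
  let ?W = "{j. l j \<noteq> u j}"
  have eq: "y j = m * u j" if "y \<in> corridor l u m" "j \<notin> ?W" for y j
    using corridorD(3,4)[OF that(1), of j] that(2) by simp
  show "inj_on (\<lambda>y. restrict y ?W) (corridor l u m)"
  proof (rule inj_onI, rule ext)
    fix y z j assume yz: "y \<in> corridor l u m" "z \<in> corridor l u m" "restrict y ?W = restrict z ?W"
    show "y j = z j"
    proof (cases "j \<in> ?W")
      case True
      then show ?thesis using fun_cong[OF yz(3), of j] by simp
    qed (simp add: eq yz)
  qed
  show "(\<lambda>y. restrict y ?W) ` corridor l u m \<subseteq> (\<Pi>\<^sub>E j\<in>?W. {..m * u j})"
    using corridorD(4) by (auto intro!: restrict_PiE)
  show "finite (\<Pi>\<^sub>E j\<in>?W. {..m * u j})"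
    using assms by (intro finite_PiE) auto
qed

text \<open>Division with remainder by \<open>m\<close>: the quotient is a height function with steps \<open>0\<close> and \<open>1\<close>, and
  the remainders form a fence map on the indices where the quotient is below \<open>u\<close>.  Where the quotient
  equals \<open>u\<close>, the remainder is \<open>0\<close>; since \<open>u\<close> also has steps \<open>0\<close> and \<open>1\<close>, such a zero
  imposes nothing on the remainders next to it.\<close>

lemma card_corridor:
  assumes m: "0 < m" and u: "u \<in> corridor l u 1" and fin: "finite {j. l j \<noteq> u j}"
  shows "card (corridor l u m) =
    (\<Sum>a\<in>corridor l u 1. card (fence_maps {j. a j < a (Suc j)} {j. a j < u j} m))"
proof -
  let ?F = "\<lambda>a. fence_maps {j. a j < a (Suc j)} {j. a j < u j} m"
  let ?f = "\<lambda>y. (\<lambda>j. y j div m, restrict (\<lambda>j. y j mod m) {j. y j div m < u j})"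
  let ?g = "\<lambda>(a, r) j. m * a j + (if a j < u j then r j else 0)"
  have u_steps: "u j \<le> u (Suc j)" "u (Suc j) \<le> Suc (u j)" for j
    using corridorD(1,2)[OF u, of j] by simp_all
  have div_le: "y j div m \<le> u j" if "y \<in> corridor l u m" for y j
    using div_le_mono[OF corridorD(4)[OF that, of j], of m] m by simp
  have top: "y j mod m = 0" if "y \<in> corridor l u m" "\<not> y j div m < u j" for y j
  proof -
    have "y j div m = u j" using div_le[OF that(1), of j] that(2) by simp
    then have "m * u j + y j mod m = y j" by (metis mult_div_mod_eq)
    then show ?thesis using corridorD(4)[OF that(1), of j] by simp
  qed
  have "bij_betw ?f (corridor l u m) (SIGMA a:corridor l u 1. ?F a)"
  proof (rule bij_betw_byWitness[where f' = ?g])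
    show "\<forall>y\<in>corridor l u m. ?g (?f y) = y"
    proof
      fix y assume y: "y \<in> corridor l u m"
      show "?g (?f y) = y"
      proof
        fix j
        show "?g (?f y) j = y j"
          using top[OF y, of j] mult_div_mod_eq[of m "y j"] by auto
      qed
    qed
    show "\<forall>ar\<in>(SIGMA a:corridor l u 1. ?F a). ?f (?g ar) = ar"
    proof
      fix ar assume "ar \<in> (SIGMA a:corridor l u 1. ?F a)"
      then obtain a r where ar: "ar = (a, r)" and a: "a \<in> corridor l u 1" and r: "r \<in> ?F a"
        by auto
      have r_less: "r j < m" if "a j < u j" for j
        using r that by (auto simp: rel_maps_def)
      have d: "(\<lambda>j. ?g ar j div m) = a"
        using m r_less by (auto simp: ar)
      have "restrict (\<lambda>j. ?g ar j mod m) {j. a j < u j} = r"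
        using r r_less by (auto simp: ar rel_maps_def PiE_iff extensional_def fun_eq_iff)
      then show "?f (?g ar) = ar"
        using d by (simp add: ar fun_eq_iff)
    qed
    show "?f ` corridor l u m \<subseteq> (SIGMA a:corridor l u 1. ?F a)"
    proof (rule image_subsetI)
      fix y assume y: "y \<in> corridor l u m"
      let ?a = "\<lambda>j. y j div m"
      have steps: "?a j \<le> ?a (Suc j)" "?a (Suc j) \<le> Suc (?a j)" for j
        using div_le_mono[OF corridorD(1)[OF y, of j], of m]
          div_le_mono[OF corridorD(2)[OF y, of j], of m] m by simp_all
      have "l j \<le> ?a j" for j
        using div_le_mono[OF corridorD(3)[OF y, of j], of m] m by simp
      then have a: "?a \<in> corridor l u 1"
        using steps div_le[OF y] by (simp add: corridor_def)
      have "fence_rel {j. ?a j < ?a (Suc j)} {} j (y j mod m) (y (Suc j) mod m)" for j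
      proof (cases "?a j < ?a (Suc j)")
        case True
        then have s: "?a (Suc j) = Suc (?a j)" using steps[of j] by simp
        have "y (Suc j) mod m \<le> y j mod m"
          using corridorD(2)[OF y, of j] mult_div_mod_eq[of m "y j"] mult_div_mod_eq[of m "y (Suc j)"]
          unfolding s mult_Suc_right by linarith
        then show ?thesis using True by (simp add: fence_rel_def)
      next
        case False
        then have s: "?a (Suc j) = ?a j" using steps[of j] by simp
        have "y j mod m \<le> y (Suc j) mod m"
          using corridorD(1)[OF y, of j] mult_div_mod_eq[of m "y j"] mult_div_mod_eq[of m "y (Suc j)"]
          unfolding s by linarith
        then show ?thesis using False by (simp add: fence_rel_def)
      qed
      then have "restrict (\<lambda>j. y j mod m) {j. ?a j < u j} \<in> ?F ?a"
        using m by (auto simp: rel_maps_def)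
      then show "?f y \<in> (SIGMA a:corridor l u 1. ?F a)"
        using a by simp
    qed
    show "?g ` (SIGMA a:corridor l u 1. ?F a) \<subseteq> corridor l u m"
    proof (rule image_subsetI)
      fix ar assume "ar \<in> (SIGMA a:corridor l u 1. ?F a)"
      then obtain a r where ar: "ar = (a, r)" and a: "a \<in> corridor l u 1" and r: "r \<in> ?F a"
        by auto
      define r' where "r' = (\<lambda>j. if a j < u j then r j else 0)"
      have r_less: "r' j < m" for j
        using r m by (auto simp: rel_maps_def r'_def)
      have rel: "fence_rel {j. a j < a (Suc j)} {} j (r j) (r (Suc j))" if "a j < u j" "a (Suc j) < u (Suc j)" for j
        using r that by (auto simp: rel_maps_def)
      have a_steps: "a j \<le> a (Suc j)" "a (Suc j) \<le> Suc (a j)" and a_bounds: "l j \<le> a j" "a j \<le> u j" for j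
        using corridorD[OF a, of j] by simp_all
      have g: "?g ar j = m * a j + r' j" for j by (simp add: ar r'_def)
      have step: "?g ar j \<le> ?g ar (Suc j) \<and> ?g ar (Suc j) \<le> ?g ar j + m" for j
      proof (cases "a j < a (Suc j)")
        case True
        then have s: "a (Suc j) = Suc (a j)" using a_steps[of j] by simp
        have "r' (Suc j) \<le> r' j"
          using rel[of j] True s u_steps(2)[of j] by (auto simp: fence_rel_def r'_def)
        then show ?thesis
          unfolding g s using r_less[of j] by simp
      next
        case False
        then have s: "a (Suc j) = a j" using a_steps[of j] by simp
        have "r' j \<le> r' (Suc j)"
          using rel[of j] False s u_steps(1)[of j] by (auto simp: fence_rel_def r'_def)
        then show ?thesis
          unfolding g s using r_less[of "Suc j"] by simp
      qed
      have lower: "m * l j \<le> ?g ar j" for j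
        unfolding g using mult_le_mono2[OF a_bounds(1), of m j] by (simp add: trans_le_add1)
      have upper: "?g ar j \<le> m * u j" for j
      proof (cases "a j < u j")
        case True
        then have "m * Suc (a j) \<le> m * u j" by (intro mult_le_mono2) simp
        then show ?thesis unfolding g using r_less[of j] by simp
      next
        case False
        then show ?thesis unfolding g using a_bounds(2)[of j] by (simp add: r'_def)
      qed
      show "?g ar \<in> corridor l u m"
        using step lower upper unfolding corridor_def by blast
    qed
  qed
  moreover have "finite {j. a j < u j}" if "a \<in> corridor l u 1" for a
  proof (rule finite_subset[OF _ fin])
    have "l j \<le> a j" for j using corridorD(3)[OF that, of j] by simp
    then show "{j. a j < u j} \<subseteq> {j. l j \<noteq> u j}" by (metis (mono_tags, lifting) Collect_mono not_le)
  qed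
  ultimately show ?thesis
    using finite_corridor[OF fin, of 1] by (simp add: bij_betw_same_card finite_rel_maps)
qed

section \<open>Integer points of dilated base polytopes\<close>

lemma lookup_scaleR: "Poly_Mapping.lookup (c *\<^sub>R x) i = c * Poly_Mapping.lookup (x :: 'a \<Rightarrow>\<^sub>0 real) i"
proof -
  have "finite {i. c *\<^sub>R Poly_Mapping.lookup x i \<noteq> 0}"
    by (rule finite_subset[OF _ finite_lookup[of x]]) auto
  then show ?thesis
    by (simp add: scaleR_poly_mapping_def)
qed

lemma lookup_indicator_vector:
  "finite A \<Longrightarrow> Poly_Mapping.lookup (indicator_vector A) i = of_bool (i \<in> A)"
  by (simp add: indicator_vector_def lookup_sum lookup_single when_def)

text \<open>If \<open>A\<close> is the set of north steps of a path, this is its height after \<open>j\<close> steps.\<close>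

definition height :: "nat set \<Rightarrow> nat \<Rightarrow> nat" where
  "height A j = card (A \<inter> {1..j})"

lemma height_0 [simp]: "height A 0 = 0"
  by (simp add: height_def)

lemma height_Suc: "height A (Suc j) = height A j + of_bool (Suc j \<in> A)"
  unfolding height_def by (rule card_Int_Suc)

lemma height_full: "A \<subseteq> {1..n} \<Longrightarrow> n \<le> j \<Longrightarrow> height A j = card A"
  unfolding height_def by (metis Int_absorb2 atLeastatMost_subset_iff order_refl order_trans)

lemma height_lattice_path:
  assumes "k \<le> n" "P \<in> lattice_paths n k" "n \<le> j"
  shows "height (north_steps P) j = k"
  using assms north_steps_subset[of P] height_full[of "north_steps P" n j] by (simp add: lattice_paths_iff)

text \<open>The vector whose partial sums are the values of \<open>y\<close>, for \<open>y\<close> increasing on \<open>{0..n}\<close> with \<open>y 0 = 0\<close>.\<close>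

definition increments :: "nat \<Rightarrow> (nat \<Rightarrow> nat) \<Rightarrow> nat \<Rightarrow>\<^sub>0 real" where
  "increments n y = (\<Sum>j\<in>{1..n}. Poly_Mapping.single j (real (y j - y (j - 1))))"

lemma lookup_increments:
  "Poly_Mapping.lookup (increments n y) i = (if i \<in> {1..n} then real (y i - y (i - 1)) else 0)"
  by (simp add: increments_def lookup_sum lookup_single when_def)

text \<open>Hermite's identity, for the natural number \<open>y\<close> in units of \<open>1 / m\<close>.\<close>

lemma sum_div_shift:
  fixes m y :: nat
  assumes "0 < m"
  shows "(\<Sum>i<m. (y + i) div m) = y"
proof (induction y)
  case 0
  show ?case by simp
next
  case (Suc y)
  have "(\<Sum>i<m. (Suc y + i) div m) + y div m = (\<Sum>i<Suc m. (y + i) div m)"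
    by (subst sum.lessThan_Suc_shift) simp
  also have "\<dots> = y + (y + m) div m" using Suc by simp
  finally show ?case using assms by simp
qed

lemma shift_div_in_corridor:
  assumes "0 < m" "i < m" "y \<in> corridor l u m"
  shows "(\<lambda>j. (y j + i) div m) \<in> corridor l u 1"
proof -
  have "(y j + i) div m \<le> (y (Suc j) + i) div m \<and> (y (Suc j) + i) div m \<le> (y j + i) div m + 1 \<and>
      l j \<le> (y j + i) div m \<and> (y j + i) div m \<le> u j" for j
  proof -
    note y = corridorD[OF assms(3), of j]
    have "(y (Suc j) + i) div m \<le> (y j + i + m) div m"
      using y(2) by (intro div_le_mono) simp
    moreover have "m * l j div m \<le> (y j + i) div m"
      using y(3) by (intro div_le_mono) simp
    moreover have "(y j + i) div m \<le> (m * u j + i) div m"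
      using y(4) by (intro div_le_mono) simp
    ultimately show ?thesis
      using assms(1,2) y(1) by (simp add: div_le_mono)
  qed
  then show ?thesis by (simp add: corridor_def)
qed

lemma increments_decompose:
  assumes "0 < m" "y \<in> corridor l u m"
  shows "increments n y = (\<Sum>i<m. increments n (\<lambda>j. (y j + i) div m))"
proof (rule poly_mapping_eqI)
  fix j
  show "Poly_Mapping.lookup (increments n y) j =
      Poly_Mapping.lookup (\<Sum>i<m. increments n (\<lambda>j. (y j + i) div m)) j"
  proof (cases "j \<in> {1..n}")
    case True
    then obtain p where p: "j = Suc p" by (cases j) auto
    have "(\<Sum>i<m. real ((y (Suc p) + i) div m - (y p + i) div m)) =
        (\<Sum>i<m. real ((y (Suc p) + i) div m)) - (\<Sum>i<m. real ((y p + i) div m))"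
      using corridorD(1)[OF assms(2), of p]
      by (simp add: of_nat_diff div_le_mono flip: sum_subtractf)
    also have "\<dots> = real (y (Suc p)) - real (y p)"
      using sum_div_shift[OF assms(1)] by (simp flip: of_nat_sum)
    also have "\<dots> = real (y (Suc p) - y p)"
      using corridorD(1)[OF assms(2), of p] by (simp add: of_nat_diff)
    finally show ?thesis using True by (simp add: lookup_increments lookup_sum p)
  next
    case False
    show ?thesis unfolding lookup_sum lookup_increments if_not_P[OF False] by simp
  qed
qed

lemma convex_coordinate_bounds:
  "convex {x :: 'a \<Rightarrow>\<^sub>0 real. \<forall>A\<in>F. lo A \<le> (\<Sum>i\<in>A. Poly_Mapping.lookup x i) \<and>
      (\<Sum>i\<in>A. Poly_Mapping.lookup x i) \<le> hi A}"
proof (rule convexI, clarify)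
  fix x y :: "'a \<Rightarrow>\<^sub>0 real" and s t :: real and A
  assume x: "\<forall>A\<in>F. lo A \<le> (\<Sum>i\<in>A. Poly_Mapping.lookup x i) \<and> (\<Sum>i\<in>A. Poly_Mapping.lookup x i) \<le> hi A"
    and y: "\<forall>A\<in>F. lo A \<le> (\<Sum>i\<in>A. Poly_Mapping.lookup y i) \<and> (\<Sum>i\<in>A. Poly_Mapping.lookup y i) \<le> hi A"
    and st: "0 \<le> s" "0 \<le> t" "s + t = 1" and A: "A \<in> F"
  let ?X = "\<Sum>i\<in>A. Poly_Mapping.lookup x i" and ?Y = "\<Sum>i\<in>A. Poly_Mapping.lookup y i"
  have eq: "(\<Sum>i\<in>A. Poly_Mapping.lookup (s *\<^sub>R x + t *\<^sub>R y) i) = s * ?X + t * ?Y"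
    by (simp add: lookup_add lookup_scaleR sum.distrib sum_distrib_left)
  have "s * ?X + t * ?Y \<le> hi A"
    using x y A st by (intro convex_bound_le) auto
  moreover have "s * (- ?X) + t * (- ?Y) \<le> - lo A"
    using x y A st by (intro convex_bound_le) auto
  ultimately show "lo A \<le> (\<Sum>i\<in>A. Poly_Mapping.lookup (s *\<^sub>R x + t *\<^sub>R y) i) \<and>
      (\<Sum>i\<in>A. Poly_Mapping.lookup (s *\<^sub>R x + t *\<^sub>R y) i) \<le> hi A"
    unfolding eq by simp
qed

lemma corridor_0: "y \<in> corridor l u m \<Longrightarrow> u 0 = 0 \<Longrightarrow> y 0 = 0"
  using corridorD(4)[of y l u m 0] by simp

text \<open>Height functions with steps \<open>0\<close> and \<open>1\<close> between those of \<open>L\<close> and \<open>U\<close> are the heights of paths.\<close>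

lemma increments_in_bases:
  assumes "k \<le> n" "L \<in> lattice_paths n k" "U \<in> lattice_paths n k"
    and y: "y \<in> corridor (height (north_steps L)) (height (north_steps U)) 1"
  shows "increments n y \<in> indicator_vector ` bases (lattice_path_matroid n k L U)"
proof -
  define A where "A = {i \<in> {1..n}. y (i - 1) < y i}"
  have fin: "finite A" by (simp add: A_def)
  note end_heights = height_lattice_path[OF assms(1,2)] height_lattice_path[OF assms(1,3)]
  have step: "y (Suc j) = y j + of_bool (y j < y (Suc j))" for j
    using corridorD(1,2)[OF y, of j] by simp
  have y_0: "y 0 = 0" using corridor_0[OF y] by simp
  have height_A: "height A j = y j" if "j \<le> n" for j
    using that
  proof (induction j)
    case 0
    then show ?case by (simp add: y_0)
  next
    case (Suc j)
    then show ?case using step[of j] by (simp add: height_Suc A_def)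
  qed
  have "card A = k"
  proof -
    have "card A = height A n" by (rule height_full[symmetric]) (auto simp: A_def)
    also have "\<dots> = y n" by (simp add: height_A)
    also have "\<dots> = k"
      using corridorD(3,4)[OF y, of n] by (simp add: end_heights)
    finally show ?thesis .
  qed
  moreover have "height (north_steps L) j \<le> height A j \<and> height A j \<le> height (north_steps U) j"
    if "j \<le> n" for j
    using corridorD(3,4)[OF y, of j] height_A[OF that] by simp
  ultimately have "A \<in> lattice_path_bases n k L U"
    unfolding lattice_path_bases_eq[OF assms(1)] by (auto simp: A_def height_def)
  moreover have "increments n y = indicator_vector A"
  proof (rule poly_mapping_eqI)
    fix i
    show "Poly_Mapping.lookup (increments n y) i = Poly_Mapping.lookup (indicator_vector A) i"
      using fin step[of "i - 1"] by (cases i) (auto simp: lookup_increments lookup_indicator_vector A_def)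
  qed
  ultimately show ?thesis by (simp add: lattice_path_matroid_def)
qed

lemma base_polytope_bounds:
  assumes "k \<le> n" "L \<in> lattice_paths n k" "U \<in> lattice_paths n k"
    and x: "x \<in> base_polytope (lattice_path_matroid n k L U)"
  shows "real (height (north_steps L) j) \<le> (\<Sum>i\<in>{1..j}. Poly_Mapping.lookup x i)"
    and "(\<Sum>i\<in>{1..j}. Poly_Mapping.lookup x i) \<le> real (height (north_steps U) j)"
    and "0 \<le> Poly_Mapping.lookup x i" and "Poly_Mapping.lookup x i \<le> of_bool (i \<in> {1..n})"
proof -
  let ?B = "indicator_vector ` bases (lattice_path_matroid n k L U)"
  let ?l = "height (north_steps L)" and ?u = "height (north_steps U)"
  note end_heights = height_lattice_path[OF assms(1,2)] height_lattice_path[OF assms(1,3)]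
  have hull: "x \<in> K" if "?B \<subseteq> K" "convex K" for K
    using x hull_minimal[of ?B K convex] that by (auto simp: base_polytope_def)
  have base: "\<exists>A. v = indicator_vector A \<and> finite A \<and> A \<subseteq> {1..n} \<and> ?l j \<le> height A j \<and> height A j \<le> ?u j"
    if "v \<in> ?B" for v j
  proof -
    from that obtain A where A: "v = indicator_vector A" "A \<in> lattice_path_bases n k L U"
      by (auto simp: lattice_path_matroid_def)
    then have An: "A \<subseteq> {1..n}" "card A = k"
      and bounds: "\<And>m. m \<in> {1..n} \<Longrightarrow> ?l m \<le> height A m \<and> height A m \<le> ?u m"
      by (auto simp: lattice_path_bases_eq[OF assms(1)] height_def)
    have "?l j \<le> height A j \<and> height A j \<le> ?u j"
    proof (cases "j \<in> {1..n}")
      case False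
      then consider "j = 0" | "n \<le> j" by fastforce
      then show ?thesis
        using height_full[OF An(1), of j] An(2) by cases (auto simp: end_heights)
    qed (rule bounds)
    then show ?thesis using A An finite_subset[OF An(1)] by auto
  qed
  have sum_indicator: "(\<Sum>i\<in>{1..j}. Poly_Mapping.lookup (indicator_vector A) i) = real (height A j)"
    if "finite A" for A j
    using that by (simp add: lookup_indicator_vector height_def Int_commute)
  let ?K = "\<lambda>j. {x :: nat \<Rightarrow>\<^sub>0 real. \<forall>A\<in>{{1..j}}. real (?l j) \<le> (\<Sum>i\<in>A. Poly_Mapping.lookup x i) \<and>
      (\<Sum>i\<in>A. Poly_Mapping.lookup x i) \<le> real (?u j)}"
  have "?B \<subseteq> ?K j" for j
  proof
    fix v assume "v \<in> ?B"
    from base[OF this, of j] show "v \<in> ?K j"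
      using sum_indicator by fastforce
  qed
  then have "x \<in> ?K j" by (intro hull convex_coordinate_bounds)
  then show "real (?l j) \<le> (\<Sum>i\<in>{1..j}. Poly_Mapping.lookup x i)"
    and "(\<Sum>i\<in>{1..j}. Poly_Mapping.lookup x i) \<le> real (?u j)" by simp_all
  let ?K = "{x :: nat \<Rightarrow>\<^sub>0 real. \<forall>A\<in>{{i}}. 0 \<le> (\<Sum>i\<in>A. Poly_Mapping.lookup x i) \<and>
      (\<Sum>i\<in>A. Poly_Mapping.lookup x i) \<le> of_bool (i \<in> {1..n})}"
  have "?B \<subseteq> ?K"
  proof
    fix v assume "v \<in> ?B"
    from base[OF this, of 0] show "v \<in> ?K"
      by (auto simp: lookup_indicator_vector)
  qed
  then have "x \<in> ?K" by (intro hull convex_coordinate_bounds)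
  then show "0 \<le> Poly_Mapping.lookup x i" "Poly_Mapping.lookup x i \<le> of_bool (i \<in> {1..n})" by simp_all
qed

lemma bij_betw_increments:
  assumes "k \<le> n" "L \<in> lattice_paths n k" "U \<in> lattice_paths n k" and m: "0 < m"
  shows "bij_betw (increments n) (corridor (height (north_steps L)) (height (north_steps U)) m)
    ((\<lambda>v. real m *\<^sub>R v) ` base_polytope (lattice_path_matroid n k L U) \<inter> integer_points)"
    (is "bij_betw _ (corridor ?l ?u m) ?X")
proof (rule bij_betw_imageI)
  let ?P = "base_polytope (lattice_path_matroid n k L U)"
  note end_heights = height_lattice_path[OF assms(1,2)] height_lattice_path[OF assms(1,3)]
  show "inj_on (increments n) (corridor ?l ?u m)"
  proof (rule inj_onI, rule ext)
    fix y z j assume y: "y \<in> corridor ?l ?u m" and z: "z \<in> corridor ?l ?u m"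
      and eq: "increments n y = increments n z"
    have const: "w j = m * k" if "w \<in> corridor ?l ?u m" "n \<le> j" for w j
      using corridorD(3,4)[OF that(1), of j] by (simp add: end_heights that(2))
    have "y j = z j" if "j \<le> n" for j
      using that
    proof (induction j)
      case 0
      then show ?case using corridor_0[OF y] corridor_0[OF z] by simp
    next
      case (Suc j)
      then have "y (Suc j) - y j = z (Suc j) - z j"
        using arg_cong[OF eq, of "\<lambda>x. Poly_Mapping.lookup x (Suc j)"] by (simp add: lookup_increments)
      then show ?case
        using Suc corridorD(1)[OF y, of j] corridorD(1)[OF z, of j] by simp
    qed
    then show "y j = z j" using const[OF y, of j] const[OF z, of j] by (cases "j \<le> n") auto
  qed
  show "increments n ` corridor ?l ?u m = ?X"
  proof (intro equalityI subsetI)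
    fix x assume "x \<in> increments n ` corridor ?l ?u m"
    then obtain y where x: "x = increments n y" and y: "y \<in> corridor ?l ?u m" by auto
    let ?v = "\<lambda>i. increments n (\<lambda>j. (y j + i) div m)"
    have "?v i \<in> ?P" if "i < m" for i
      unfolding base_polytope_def
      by (intro hull_inc increments_in_bases[OF assms(1-3)] shift_div_in_corridor[OF m that y])
    then have "(\<Sum>i<m. (1 / real m) *\<^sub>R ?v i) \<in> ?P"
      using m by (intro convex_sum) (auto simp: base_polytope_def)
    moreover have "x = real m *\<^sub>R (\<Sum>i<m. (1 / real m) *\<^sub>R ?v i)"
      using m by (simp add: x increments_decompose[OF m y, of n] scaleR_sum_right)
    moreover have "x \<in> integer_points"
      by (simp add: x integer_points_def lookup_increments)
    ultimately show "x \<in> ?X" by blast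
  next
    fix x assume "x \<in> ?X"
    then obtain p where x: "x = real m *\<^sub>R p" and p: "p \<in> ?P" and int: "x \<in> integer_points" by auto
    note bounds = base_polytope_bounds[OF assms(1-3) p]
    have "\<exists>c. Poly_Mapping.lookup x i = real c" for i
    proof -
      have "Poly_Mapping.lookup x i \<in> \<int>" "0 \<le> Poly_Mapping.lookup x i"
        using int bounds(3)[of i] by (simp_all add: integer_points_def x lookup_scaleR)
      then show ?thesis by (metis Ints_cases nonneg_int_cases of_int_0_le_iff of_int_of_nat_eq)
    qed
    then obtain c where c: "\<And>i. Poly_Mapping.lookup x i = real (c i)" by metis
    have c_le: "real (c i) \<le> real m * of_bool (i \<in> {1..n})" for i
      unfolding c[symmetric] x lookup_scaleR using bounds(4)[of i] by (intro mult_left_mono) auto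
    define y where "y j = (\<Sum>i\<in>{1..j}. c i)" for j
    have y_Suc: "y (Suc j) = y j + c (Suc j)" for j by (simp add: y_def)
    have y_real: "real (y j) = real m * (\<Sum>i\<in>{1..j}. Poly_Mapping.lookup p i)" for j
      by (simp add: y_def c[symmetric] x lookup_scaleR sum_distrib_left)
    have "m * ?l j \<le> y j \<and> y j \<le> m * ?u j" for j
    proof -
      have "real m * real (?l j) \<le> real (y j)" "real (y j) \<le> real m * real (?u j)"
        unfolding y_real using bounds(1,2)[of j] by (simp_all add: mult_left_mono)
      then show ?thesis by (simp flip: of_nat_mult)
    qed
    moreover have "c (Suc j) \<le> m" for j
      using c_le[of "Suc j"] by (simp add: of_bool_def split: if_splits)
    ultimately have "y \<in> corridor ?l ?u m"
      by (simp add: corridor_def y_Suc)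
    moreover have "x = increments n y"
    proof (rule poly_mapping_eqI)
      fix i
      have "y i - y (i - 1) = c i" if "1 \<le> i"
        using y_Suc[of "i - 1"] that by simp
      then show "Poly_Mapping.lookup x i = Poly_Mapping.lookup (increments n y) i"
        using c_le[of i] by (auto simp: c lookup_increments)
    qed
    ultimately show "x \<in> increments n ` corridor ?l ?u m" by blast
  qed
qed

section \<open>Ehrhart positivity\<close>

theorem theorem1p2:
  fixes n k :: nat and L U :: "step list"
  assumes "k \<le> n"
    and "L \<in> lattice_paths n k" and "U \<in> lattice_paths n k"
    and "lies_below n L U"
  shows "\<forall>i. 0 \<le> coeff (ehrhart_polynomial (base_polytope (lattice_path_matroid n k L U))) i"
proof -
  let ?l = "height (north_steps L)" and ?u = "height (north_steps U)"
  let ?P = "base_polytope (lattice_path_matroid n k L U)"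
  let ?C = "corridor ?l ?u 1"
  let ?D = "\<lambda>a :: nat \<Rightarrow> nat. {j. a j < a (Suc j)}" and ?V = "\<lambda>a. {j. a j < ?u j}"
  note end_heights = height_lattice_path[OF assms(1,2)] height_lattice_path[OF assms(1,3)]
  have le: "?l j \<le> ?u j" for j
  proof (cases "j \<in> {1..n}")
    case True
    then show ?thesis using assms(4) by (simp add: lies_below_def height_def)
  next
    case False
    then consider "j = 0" | "n \<le> j" by fastforce
    then show ?thesis
      by cases (simp_all add: end_heights)
  qed
  have u: "?u \<in> ?C"
    using le by (simp add: corridor_def height_Suc)
  have "?l j = ?u j" if "n \<le> j" for j
    using that by (simp add: end_heights)
  then have "{j. ?l j \<noteq> ?u j} \<subseteq> {..n}"
    by (metis (mono_tags, lifting) atMost_iff mem_Collect_eq nle_le subsetI)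
  then have fin: "finite {j. ?l j \<noteq> ?u j}"
    by (rule finite_subset) simp
  have fin_C: "finite ?C"
    using fin by (rule finite_corridor)
  have "finite (?V a)" if "a \<in> ?C" for a
  proof (rule finite_subset[OF _ fin])
    have "?l j \<le> a j" for j using corridorD(3)[OF that, of j] by simp
    then show "?V a \<subseteq> {j. ?l j \<noteq> ?u j}"
      by (metis (mono_tags, lifting) Collect_mono not_le)
  qed
  then have "\<forall>a\<in>?C. \<exists>q :: rat poly. (\<forall>m::nat. poly q (of_nat m) = of_nat (card (fence_maps (?D a) (?V a) m))) \<and>
      (\<forall>i. 0 \<le> coeff q i)"
    by (intro ballI fence_poly_nonneg)
  from bchoice[OF this] obtain q :: "(nat \<Rightarrow> nat) \<Rightarrow> rat poly" where
    "\<forall>a\<in>?C. (\<forall>m::nat. poly (q a) (of_nat m) = of_nat (card (fence_maps (?D a) (?V a) m))) \<and>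
      (\<forall>i. 0 \<le> coeff (q a) i)" ..
  then have q: "poly (q a) (of_nat m) = of_nat (card (fence_maps (?D a) (?V a) m))"
    and q_nonneg: "0 \<le> coeff (q a) i" if "a \<in> ?C" for a i and m :: nat
    using that by simp_all
  have "is_ehrhart_polynomial ?P (\<Sum>a\<in>?C. q a)"
    unfolding is_ehrhart_polynomial_def
  proof
    fix m :: nat
    have "card ((\<lambda>v. real m *\<^sub>R v) ` ?P \<inter> integer_points) =
        (\<Sum>a\<in>?C. card (fence_maps (?D a) (?V a) m))"
    proof (cases "m = 0")
      case False
      then show ?thesis
        using bij_betw_same_card[OF bij_betw_increments[OF assms(1-3)]] card_corridor[OF _ u fin] by simp
    next
      \<comment> \<open>Both sides are \<open>1\<close>: only the path \<open>a = U\<close> has an empty fence, and nonempty fences have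
        no maps to the empty set.\<close>
      case True
      have "?P \<noteq> {}"
        using increments_in_bases[OF assms(1-3) u] by (auto simp: base_polytope_def)
      then have "(\<lambda>v. real m *\<^sub>R v) ` ?P \<inter> integer_points = {0}"
        using True by (auto simp: integer_points_def)
      moreover have "card (fence_maps (?D a) (?V a) m) = of_bool (a = ?u)" if "a \<in> ?C" for a
      proof (cases "?V a = {}")
        case True
        then have "a = ?u"
          using corridorD(4)[OF that] by (auto simp: fun_eq_iff intro: antisym simp flip: not_less)
        then show ?thesis by simp
      next
        case False
        then have "a \<noteq> ?u" by auto
        then show ?thesis using rel_maps_zero[OF False] True by simp
      qed
      ultimately show ?thesis
        using u fin_C by (simp add: of_bool_def)
    qed
    then show "poly (\<Sum>a\<in>?C. q a) (of_nat m) =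
        of_nat (card ((\<lambda>v. real m *\<^sub>R v) ` ?P \<inter> integer_points))"
      by (simp add: poly_sum q)
  qed
  then show ?thesis
    using q_nonneg by (simp add: ehrhart_polynomial_eqI coeff_sum sum_nonneg)
qed

end
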